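(* Let $b>0$, $\varepsilon\ge0$, $\tau>0$, and let $g$ be the map $$g(\sigma_1,\sigma_2,\sigma_3)=(\sigma_3-\sigma_2,\ \sigma_1-\sigma_2,\ \tau-\sigma_2)$$ on the set $\Omega_{\varepsilon,\tau}$ defined in the context. Then $g$ on $\Omega_{\varepsilon,\tau}$ has period $4$, that is, $g^4(\boldsymbol\sigma)=\boldsymbol\sigma$ for all $\boldsymbol\sigma\in\Omega_{\varepsilon,\tau}$. The point $\boldsymbol\sigma_*:=(\tau/2,\tau/4,3\tau/4)\in\Omega_{\varepsilon,\tau}$ is a fixed point of $g$, and points $\boldsymbol\sigma\in\Omega_{\varepsilon,\tau}$ along the line parameterized by $\boldsymbol\sigma=\boldsymbol\sigma_*+t(0,1,1)$, $t\in\mathbb R$, are period-$2$ points of $g$.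
   Context: Put $\hat\varepsilon=\varepsilon/2$, $H(\theta)=e^{b\hat\varepsilon}\theta+\frac{e^{b\hat\varepsilon}-1}{e^b-1}$ and $H_*=H^{-1}(1)=\frac{e^b-e^{b\hat\varepsilon}}{(e^b-1)e^{b\hat\varepsilon}}$. For $\boldsymbol\sigma=(\sigma_1,\sigma_2,\sigma_3)$ let $F_1=H(\sigma_1)+\tau-\sigma_3$, $F_2=H(\tau-\sigma_3+\sigma_2)+\sigma_3-\sigma_1$, $F_3=H(\tau-\sigma_1)+\sigma_1-\sigma_2$, $F_4=H(\sigma_3-\sigma_2)+\sigma_2$. Then $\Omega_{\varepsilon,\tau}\subset\mathbb R^3$ is the set of $\boldsymbol\sigma$ with $0<\sigma_2<\sigma_1<\sigma_3<\tau$ and $H_*\le F_k\le 1$ for $k=1,2,3,4$. The map $g$ satisfies $g(\Omega_{\varepsilon,\tau})=\Omega_{\varepsilon,\tau}$. Periods are not required to be minimal: a period-$2$ point is a point with $g^2(\boldsymbol\sigma)=\boldsymbol\sigma$.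
   Formalization: The claim that σ_* lies in Ω_{ε,τ} is proved under the added condition that Ω_{ε,τ} is nonempty; without it the claim fails, e.g. for ε=0 and τ>4/3, where Ω_{ε,τ} is empty. *)

theory Defs
  imports "HOL-Analysis.Analysis"
begin

definition H :: "real \<Rightarrow> real \<Rightarrow> real \<Rightarrow> real" where
  "H b \<epsilon> \<theta> = exp (b * (\<epsilon> / 2)) * \<theta> + (exp (b * (\<epsilon> / 2)) - 1) / (exp b - 1)"

definition H_star :: "real \<Rightarrow> real \<Rightarrow> real" where
  "H_star b \<epsilon> = inv (H b \<epsilon>) 1"

lemma bij_H: "bij (H b \<epsilon>)"
proof (rule bijI)
  show "inj (H b \<epsilon>)"
    by (rule injI) (simp add: H_def)
  show "surj (H b \<epsilon>)"
  proof (rule surjI)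
    fix y
    show "H b \<epsilon> ((y - (exp (b * (\<epsilon> / 2)) - 1) / (exp b - 1)) / exp (b * (\<epsilon> / 2))) = y"
      by (simp add: H_def)
  qed
qed

lemma H_star_closed_form:
  assumes "b > 0"
  shows "H_star b \<epsilon> =
    (exp b - exp (b * (\<epsilon> / 2))) / ((exp b - 1) * exp (b * (\<epsilon> / 2)))"
proof -
  have "exp b - 1 \<noteq> 0" using assms by simp
  then have "H b \<epsilon> ((exp b - exp (b * (\<epsilon> / 2))) / ((exp b - 1) * exp (b * (\<epsilon> / 2)))) = 1"
    by (simp add: H_def add_divide_distrib [symmetric])
  then show ?thesis
    unfolding H_star_def by (metis bij_H bij_is_inj inv_f_f)
qed

fun F1 :: "real \<Rightarrow> real \<Rightarrow> real \<Rightarrow> real \<times> real \<times> real \<Rightarrow> real" where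
  "F1 b \<epsilon> \<tau> (s1, s2, s3) = H b \<epsilon> s1 + \<tau> - s3"

fun F2 :: "real \<Rightarrow> real \<Rightarrow> real \<Rightarrow> real \<times> real \<times> real \<Rightarrow> real" where
  "F2 b \<epsilon> \<tau> (s1, s2, s3) = H b \<epsilon> (\<tau> - s3 + s2) + s3 - s1"

fun F3 :: "real \<Rightarrow> real \<Rightarrow> real \<Rightarrow> real \<times> real \<times> real \<Rightarrow> real" where
  "F3 b \<epsilon> \<tau> (s1, s2, s3) = H b \<epsilon> (\<tau> - s1) + s1 - s2"

fun F4 :: "real \<Rightarrow> real \<Rightarrow> real \<Rightarrow> real \<times> real \<times> real \<Rightarrow> real" where
  "F4 b \<epsilon> \<tau> (s1, s2, s3) = H b \<epsilon> (s3 - s2) + s2"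

definition Omega :: "real \<Rightarrow> real \<Rightarrow> real \<Rightarrow> (real \<times> real \<times> real) set" where
  "Omega b \<epsilon> \<tau> = {(s1, s2, s3). 0 < s2 \<and> s2 < s1 \<and> s1 < s3 \<and> s3 < \<tau> \<and>
     (\<forall>F \<in> {F1, F2, F3, F4}.
        H_star b \<epsilon> \<le> F b \<epsilon> \<tau> (s1, s2, s3) \<and> F b \<epsilon> \<tau> (s1, s2, s3) \<le> 1)}"

text \<open>The map is given by its formula on the whole space; since it maps \<open>Omega\<close>
  onto itself (\<open>g_image_Omega\<close> below), iterating it from a point of \<open>Omega\<close> is the
  same as iterating its restriction to \<open>Omega\<close>.\<close>

fun g :: "real \<Rightarrow> real \<times> real \<times> real \<Rightarrow> real \<times> real \<times> real" where
  "g \<tau> (s1, s2, s3) = (s3 - s2, s1 - s2, \<tau> - s2)"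

definition sigma_star :: "real \<Rightarrow> real \<times> real \<times> real" where
  "sigma_star \<tau> = (\<tau> / 2, \<tau> / 4, 3 * \<tau> / 4)"

lemma g_image_Omega: "g \<tau> ` Omega b \<epsilon> \<tau> = Omega b \<epsilon> \<tau>"
proof
  show sub: "g \<tau> ` Omega b \<epsilon> \<tau> \<subseteq> Omega b \<epsilon> \<tau>"
    by (auto simp: Omega_def algebra_simps)
  show "Omega b \<epsilon> \<tau> \<subseteq> g \<tau> ` Omega b \<epsilon> \<tau>"
  proof
    fix \<sigma> assume "\<sigma> \<in> Omega b \<epsilon> \<tau>"
    then have "g \<tau> (g \<tau> (g \<tau> \<sigma>)) \<in> Omega b \<epsilon> \<tau>" using sub by blast
    moreover have "\<sigma> = g \<tau> (g \<tau> (g \<tau> (g \<tau> \<sigma>)))" by (cases \<sigma>) simp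
    ultimately show "\<sigma> \<in> g \<tau> ` Omega b \<epsilon> \<tau>" by (rule rev_image_eqI)
  qed
qed

text \<open>\<open>Omega\<close> can be empty, for instance for \<open>\<epsilon> = 0\<close> and large \<open>\<tau>\<close>;
  \<open>sigma_star\<close> can therefore belong to \<open>Omega\<close> only in the nonempty case.\<close>

lemma Omega_empty: "\<tau> > 4 / 3 \<Longrightarrow> Omega b 0 \<tau> = {}"
  by (auto simp: Omega_def H_def)

end

(* Each F_k is affine and takes at sigma_star the mean value of F_1, ..., F_4 at any other
   point, so the bounds defining Omega pass from any of its points to sigma_star. *)
theory Submission
  imports Defs
begin

text \<open>The periodicity claims are direct computation with the affine map \<open>g\<close>;
  membership of \<open>sigma_star\<close> is the real content. Since \<open>g\<close> permutes
  \<open>F1\<close>, ..., \<open>F4\<close> cyclically and \<open>sigma_star\<close> is the mean of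
  each \<open>g\<close>-orbit, each affine \<open>F\<close> takes there the mean of the four values
  at any given point. \<open>sum_F_eq\<close> and \<open>F_sigma_star\<close> verify this
  directly.\<close>

text \<open>The four arguments of the affine \<open>H\<close> add up to \<open>2 * \<tau>\<close>,
  and the terms outside \<open>H\<close> telescope to \<open>\<tau>\<close>.\<close>

lemma sum_F_eq:
  "F1 b \<epsilon> \<tau> \<sigma> + F2 b \<epsilon> \<tau> \<sigma> + F3 b \<epsilon> \<tau> \<sigma> + F4 b \<epsilon> \<tau> \<sigma> = 4 * (H b \<epsilon> (\<tau> / 2) + \<tau> / 4)"
  by (cases \<sigma>) (simp add: H_def algebra_simps)

lemma F_sigma_star:
  assumes "F \<in> {F1, F2, F3, F4}"
  shows "F b \<epsilon> \<tau> (sigma_star \<tau>) = H b \<epsilon> (\<tau> / 2) + \<tau> / 4"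
proof -
  have "\<tau> - 3 * \<tau> / 4 + \<tau> / 4 = \<tau> / 2" "\<tau> - \<tau> / 2 = \<tau> / 2" "3 * \<tau> / 4 - \<tau> / 4 = \<tau> / 2"
    by simp_all
  then show ?thesis
    using assms by (auto simp: sigma_star_def)
qed

lemma sigma_star_in_Omega:
  assumes "\<tau> > 0" and "\<sigma> \<in> Omega b \<epsilon> \<tau>"
  shows "sigma_star \<tau> \<in> Omega b \<epsilon> \<tau>"
proof -
  have bounds: "H_star b \<epsilon> \<le> F b \<epsilon> \<tau> \<sigma> \<and> F b \<epsilon> \<tau> \<sigma> \<le> 1" if "F \<in> {F1, F2, F3, F4}" for F
    using assms(2) that unfolding Omega_def by blast
  \<comment> \<open>The mean of four numbers in an interval lies in that interval.\<close>
  have "H_star b \<epsilon> \<le> H b \<epsilon> (\<tau> / 2) + \<tau> / 4 \<and> H b \<epsilon> (\<tau> / 2) + \<tau> / 4 \<le> 1"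
    using sum_F_eq[of b \<epsilon> \<tau> \<sigma>] bounds[of F1] bounds[of F2] bounds[of F3] bounds[of F4]
    by simp
  then have "\<forall>F \<in> {F1, F2, F3, F4}.
      H_star b \<epsilon> \<le> F b \<epsilon> \<tau> (sigma_star \<tau>) \<and> F b \<epsilon> \<tau> (sigma_star \<tau>) \<le> 1"
    using F_sigma_star by metis
  then show ?thesis
    using assms(1) unfolding Omega_def sigma_star_def by simp
qed

theorem mainTheorem3:
  fixes b \<epsilon> \<tau> :: real
  assumes "b > 0" and "\<epsilon> \<ge> 0" and "\<tau> > 0"
  shows "(\<forall>\<sigma> \<in> Omega b \<epsilon> \<tau>. (g \<tau> ^^ 4) \<sigma> = \<sigma>) \<and>
    (Omega b \<epsilon> \<tau> \<noteq> {} \<longrightarrow> sigma_star \<tau> \<in> Omega b \<epsilon> \<tau>) \<and>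
    g \<tau> (sigma_star \<tau>) = sigma_star \<tau> \<and>
    (\<forall>t::real. \<forall>\<sigma> \<in> Omega b \<epsilon> \<tau>. \<sigma> = sigma_star \<tau> + t *\<^sub>R (0, 1, 1) \<longrightarrow>
       (g \<tau> ^^ 2) \<sigma> = \<sigma>)"
proof (intro conjI ballI allI impI)
  show "(g \<tau> ^^ 4) \<sigma> = \<sigma>" for \<sigma>
    by (cases \<sigma>) (simp add: eval_nat_numeral)
  show "sigma_star \<tau> \<in> Omega b \<epsilon> \<tau>" if "Omega b \<epsilon> \<tau> \<noteq> {}"
    using that sigma_star_in_Omega[OF assms(3)] by blast
  show "g \<tau> (sigma_star \<tau>) = sigma_star \<tau>"
    by (simp add: sigma_star_def)
  \<comment> \<open>On this line \<open>g\<close> is the reflection \<open>t\<close> to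
    \<open>-t\<close> about \<open>sigma_star\<close>, so its square is the identity there, inside
    \<open>Omega\<close> or not.\<close>
  show "(g \<tau> ^^ 2) \<sigma> = \<sigma>" if "\<sigma> = sigma_star \<tau> + t *\<^sub>R (0, 1, 1)" for t \<sigma>
    unfolding that by (simp add: sigma_star_def eval_nat_numeral)
qed

end
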